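(* Let $G=(VG,EG)$ be a finite simple graph with vertex set $VG=[n]$ and having no isolated vertex. Then $$\mathrm{vol}(G)=\sum_{i=1}^n \frac{\mathrm{vol}(G-i)}{2n},$$ where $G-i$ is the graph with vertex set $[n]\setminus\{i\}$ whose edges are the edges of $G$ not containing $i$.
   Context: $[n]=\{1,\dots,n\}$ with $n$ a positive integer. For a finite simple graph $G=(VG,EG)$, the graph polytope is $P(G)=\{x\in[0,1]^{VG} : x_i+x_j\le 1 \text{ for every edge } ij\in EG\}$, and $\mathrm{vol}(G)$ denotes the $|VG|$-dimensional volume (Lebesgue measure) of $P(G)$. *)

theory Defs
  imports "HOL-Analysis.Analysis"
begin

text \<open>A graph is a pair of a vertex set and a set of edges, each edge being a set of vertices.\<close>

type_synonym 'a ugraph = "'a set \<times> 'a set set"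

abbreviation vertices :: "'a ugraph \<Rightarrow> 'a set" where
  "vertices G \<equiv> fst G"

abbreviation edges :: "'a ugraph \<Rightarrow> 'a set set" where
  "edges G \<equiv> snd G"

definition finite_simple_graph :: "'a ugraph \<Rightarrow> bool" where
  "finite_simple_graph G \<longleftrightarrow>
     finite (vertices G) \<and> (\<forall>e\<in>edges G. e \<subseteq> vertices G \<and> card e = 2)"

definition isolated_vertex :: "'a ugraph \<Rightarrow> 'a \<Rightarrow> bool" where
  "isolated_vertex G i \<longleftrightarrow> i \<in> vertices G \<and> (\<forall>e\<in>edges G. i \<notin> e)"

definition delete_vertex :: "'a ugraph \<Rightarrow> 'a \<Rightarrow> 'a ugraph" where
  "delete_vertex G i = (vertices G - {i}, {e \<in> edges G. i \<notin> e})"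

text \<open>
  Points of the space of real vectors indexed by the vertex set are functions that are
  \<^const>\<open>undefined\<close> outside the vertex set, as in the library's finite product measures.
\<close>

definition graph_polytope :: "'a ugraph \<Rightarrow> ('a \<Rightarrow> real) set" where
  "graph_polytope G =
     {x \<in> vertices G \<rightarrow>\<^sub>E {0..1}. \<forall>i j. {i, j} \<in> edges G \<longrightarrow> x i + x j \<le> 1}"

text \<open>
  The Lebesgue measure on this space is the product of one-dimensional Lebesgue-Borel measures;
  the polytope is a Borel set of finite measure, so nothing is lost by the real-valued measure.
\<close>

definition graph_vol :: "'a ugraph \<Rightarrow> real" where
  "graph_vol G = measure (Pi\<^sub>M (vertices G) (\<lambda>_. lborel)) (graph_polytope G)"

end

theory Submission
  imports Defs
begin

text \<open>
  Without isolated vertices, the polytope is a cone with apex \<open>(1/2, \<dots>, 1/2)\<close>: in the coordinates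
  \<open>y = x - 1/2\<close> the edge constraints are homogeneous, and together with \<open>y\<^sub>i \<ge> - 1/2\<close> they imply
  \<open>y\<^sub>i \<le> 1/2\<close>. Hence it is the union of the pyramids with this apex over the facets
  \<open>x\<^sub>i = 0\<close>. Such a facet is a copy of the polytope of \<open>G - i\<close> at distance \<open>1/2\<close> from the apex,
  so its pyramid has volume \<open>vol(G - i) / (2n)\<close>. A point of the polytope lies in the pyramid of \<open>i\<close>
  iff its \<open>i\<close>-th coordinate is minimal, so two pyramids meet in a null set.
\<close>

section \<open>Lebesgue measure on finite products: homotheties and diagonals\<close>

lemma product_sigma_finite_lborel: "product_sigma_finite (\<lambda>_::'a. lborel :: real measure)"
  by (simp add: product_sigma_finite_def sigma_finite_lborel)

text \<open>Each coordinate contributes a factor \<open>\<bar>c\<bar>\<close> by the one-dimensional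
  affine substitution; Fubini peels off one coordinate at a time. A common shift \<open>s\<close> is
  enough because the apex of the pyramids has equal coordinates.\<close>

lemma nn_integral_PiM_lborel_affine:
  fixes s c :: real
  assumes "finite I" "c \<noteq> 0" "f \<in> borel_measurable (Pi\<^sub>M I (\<lambda>_. lborel))"
  shows "(\<integral>\<^sup>+x. f x \<partial>Pi\<^sub>M I (\<lambda>_. lborel)) =
    ennreal (\<bar>c\<bar> ^ card I) * (\<integral>\<^sup>+x. f (\<lambda>j\<in>I. s + c * x j) \<partial>Pi\<^sub>M I (\<lambda>_. lborel))"
  using assms(1,3)
proof (induction I arbitrary: f rule: finite_induct)
  case empty
  show ?case by (simp add: PiM_empty nn_integral_count_space_finite)
next
  case (insert i I)
  interpret product_sigma_finite "\<lambda>_::'a. lborel :: real measure"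
    by (rule product_sigma_finite_lborel)
  note [measurable] = insert.prems
  let ?M = "Pi\<^sub>M I (\<lambda>_. lborel :: real measure)"
  have upd [measurable]: "(\<lambda>y. x(i := y)) \<in> measurable lborel (Pi\<^sub>M (insert i I) (\<lambda>_. lborel))"
    if "x \<in> space ?M" for x :: "'a \<Rightarrow> real"
    using that insert.hyps by (intro measurable_component_update) auto
  have fupd: "(\<lambda>y. f (x(i := y))) \<in> borel_measurable borel" if "x \<in> space ?M" for x
    using measurable_comp[OF upd[OF that] insert.prems] by (simp add: o_def)
  have [measurable]: "(\<lambda>p. f ((fst p)(i := s + c * snd p))) \<in> borel_measurable (?M \<Otimes>\<^sub>M lborel)"
    by measurable
  have [measurable]: "(\<lambda>x. \<integral>\<^sup>+y. f (x(i := s + c * y)) \<partial>lborel) \<in> borel_measurable ?M"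
    by measurable
  have [measurable]: "(\<lambda>x. (\<lambda>j\<in>insert i I. s + c * x j)) \<in>
      measurable (Pi\<^sub>M (insert i I) (\<lambda>_. lborel)) (Pi\<^sub>M (insert i I) (\<lambda>_. lborel))"
    by (intro measurable_restrict) measurable
  have "(\<integral>\<^sup>+x. f x \<partial>Pi\<^sub>M (insert i I) (\<lambda>_. lborel)) =
      (\<integral>\<^sup>+x. (\<integral>\<^sup>+y. f (x(i := y)) \<partial>lborel) \<partial>?M)"
    using insert by (subst product_nn_integral_insert) auto
  also have "\<dots> = (\<integral>\<^sup>+x. ennreal \<bar>c\<bar> * (\<integral>\<^sup>+y. f (x(i := s + c * y)) \<partial>lborel) \<partial>?M)"
    using assms(2) fupd by (intro nn_integral_cong nn_integral_real_affine)
  also have "\<dots> = ennreal \<bar>c\<bar> * (\<integral>\<^sup>+x. (\<integral>\<^sup>+y. f (x(i := s + c * y)) \<partial>lborel) \<partial>?M)"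
    by (rule nn_integral_cmult) measurable
  \<comment> \<open>The induction hypothesis is applied to the function of \<open>x\<close> left
    after integrating out coordinate \<open>i\<close>, which is why \<open>f\<close> is arbitrary in
    the induction.\<close>
  also have "(\<integral>\<^sup>+x. (\<integral>\<^sup>+y. f (x(i := s + c * y)) \<partial>lborel) \<partial>?M) = ennreal (\<bar>c\<bar> ^ card I) *
      (\<integral>\<^sup>+x. (\<integral>\<^sup>+y. f ((\<lambda>j\<in>I. s + c * x j)(i := s + c * y)) \<partial>lborel) \<partial>?M)"
    by (rule insert.IH) measurable
  also have "(\<integral>\<^sup>+x. (\<integral>\<^sup>+y. f ((\<lambda>j\<in>I. s + c * x j)(i := s + c * y)) \<partial>lborel) \<partial>?M) =
      (\<integral>\<^sup>+x. (\<integral>\<^sup>+y. f (\<lambda>j\<in>insert i I. s + c * (x(i := y)) j) \<partial>lborel) \<partial>?M)"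
    using insert.hyps
    by (intro nn_integral_cong arg_cong[where f = f]) (auto simp: fun_eq_iff restrict_def)
  also have "\<dots> = (\<integral>\<^sup>+x. f (\<lambda>j\<in>insert i I. s + c * x j) \<partial>Pi\<^sub>M (insert i I) (\<lambda>_. lborel))"
    using insert.hyps by (subst product_nn_integral_insert) auto
  finally have "(\<integral>\<^sup>+x. f x \<partial>Pi\<^sub>M (insert i I) (\<lambda>_. lborel)) = (ennreal \<bar>c\<bar> * ennreal (\<bar>c\<bar> ^ card I)) *
      (\<integral>\<^sup>+x. f (\<lambda>j\<in>insert i I. s + c * x j) \<partial>Pi\<^sub>M (insert i I) (\<lambda>_. lborel))"
    by (simp only: mult.assoc)
  also have "ennreal \<bar>c\<bar> * ennreal (\<bar>c\<bar> ^ card I) = ennreal (\<bar>c\<bar> ^ card (insert i I))"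
    using insert.hyps by (simp add: ennreal_mult)
  finally show ?case .
qed

text \<open>By Fubini in coordinate \<open>i\<close>: every line in that direction meets the
  hyperplane \<open>x i = x j\<close> in one point. This makes overlaps of pyramids
  negligible.\<close>

lemma AE_PiM_lborel_neq:
  assumes "finite I" "i \<in> I" "j \<in> I" "i \<noteq> j"
  shows "AE x in Pi\<^sub>M I (\<lambda>_. lborel :: real measure). x i \<noteq> x j"
proof -
  interpret product_sigma_finite "\<lambda>_::'a. lborel :: real measure"
    by (rule product_sigma_finite_lborel)
  let ?M = "\<lambda>I. Pi\<^sub>M I (\<lambda>_::'a. lborel :: real measure)"
  let ?N = "{x \<in> space (?M I). x i = x j}"
  have I: "insert i (I - {i}) = I" using assms by auto
  have N [measurable]: "?N \<in> sets (?M I)"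
    using assms by measurable
  have "emeasure (?M I) ?N = (\<integral>\<^sup>+x. indicator ?N x \<partial>?M (insert i (I - {i})))"
    unfolding I by (rule nn_integral_indicator[symmetric, OF N])
  also have "\<dots> = (\<integral>\<^sup>+x. (\<integral>\<^sup>+y. indicator ?N (x(i := y)) \<partial>lborel) \<partial>?M (I - {i}))"
    using assms N by (intro product_nn_integral_insert borel_measurable_indicator) (simp_all add: insert_absorb)
  \<comment> \<open>Since \<open>i \<noteq> j\<close>, updating coordinate \<open>i\<close> does not
    change \<open>x j\<close>, so membership in \<open>?N\<close> forces
    \<open>y = x j\<close>.\<close>
  also have "\<dots> \<le> (\<integral>\<^sup>+x. (\<integral>\<^sup>+y. indicator {x j} y \<partial>lborel) \<partial>?M (I - {i}))"
    using assms by (intro nn_integral_mono) (auto split: split_indicator)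
  finally have "emeasure (?M I) ?N = 0" by simp
  then show ?thesis by (intro AE_I[of _ _ ?N]) auto
qed

section \<open>Measurability of the polytope and of its pyramids\<close>

lemma sets_graph_polytope [measurable]:
  assumes "finite_simple_graph G"
  shows "graph_polytope G \<in> sets (Pi\<^sub>M (vertices G) (\<lambda>_. lborel))"
proof -
  have [simp]: "finite (vertices G)" using assms by (simp add: finite_simple_graph_def)
  have V: "i \<in> vertices G \<and> j \<in> vertices G" if "{i, j} \<in> edges G" for i j
    using assms that by (force simp: finite_simple_graph_def)
  \<comment> \<open>Edges join vertices only, so the quantifiers may be bounded by the finite vertex
    set; the set becomes a finite intersection of measurable conditions.\<close>
  have "graph_polytope G = {x \<in> space (Pi\<^sub>M (vertices G) (\<lambda>_. lborel)).
      (\<forall>i\<in>vertices G. x i \<in> {0..1}) \<and>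
      (\<forall>i\<in>vertices G. \<forall>j\<in>vertices G. {i, j} \<in> edges G \<longrightarrow> x i + x j \<le> 1)}"
    using V by (fastforce simp: graph_polytope_def space_PiM PiE_iff)
  also have "\<dots> \<in> sets (Pi\<^sub>M (vertices G) (\<lambda>_. lborel))"
    by measurable
  finally show ?thesis .
qed

text \<open>The polytope lies in the unit cube, of measure 1. Finiteness allows passing from
  \<open>emeasure\<close> to the real number \<open>graph_vol\<close>.\<close>

lemma fmeasurable_graph_polytope:
  assumes "finite_simple_graph G"
  shows "graph_polytope G \<in> fmeasurable (Pi\<^sub>M (vertices G) (\<lambda>_. lborel))"
proof (rule fmeasurableI)
  interpret product_sigma_finite "\<lambda>_::'a. lborel :: real measure"
    by (rule product_sigma_finite_lborel)
  have fin: "finite (vertices G)" using assms by (simp add: finite_simple_graph_def)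
  have "emeasure (Pi\<^sub>M (vertices G) (\<lambda>_. lborel)) (graph_polytope G)
      \<le> emeasure (Pi\<^sub>M (vertices G) (\<lambda>_. lborel)) (vertices G \<rightarrow>\<^sub>E {0..1::real})"
    using fin by (intro emeasure_mono sets_PiM_I_finite) (auto simp: graph_polytope_def)
  also have "\<dots> = 1"
    using fin by (subst emeasure_PiM) auto
  finally show "emeasure (Pi\<^sub>M (vertices G) (\<lambda>_. lborel)) (graph_polytope G) < \<infinity>"
    by (simp add: order_le_less_trans)
qed (rule sets_graph_polytope[OF assms])

lemma finite_simple_graph_delete_vertex:
  "finite_simple_graph G \<Longrightarrow> finite_simple_graph (delete_vertex G i)"
  by (fastforce simp: finite_simple_graph_def delete_vertex_def)

text \<open>Minimality of the \<open>i\<close>-th coordinate replaces the convex hull of apex and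
  facet: measurability and the covering of the polytope are then immediate, and the geometry is
  confined to the description of the slices \<open>x i = s\<close>.\<close>

definition facet_pyramid :: "'a ugraph \<Rightarrow> 'a \<Rightarrow> ('a \<Rightarrow> real) set" where
  "facet_pyramid G i = {x \<in> graph_polytope G. \<forall>j\<in>vertices G. x i \<le> x j}"

lemma sets_facet_pyramid [measurable]:
  assumes "finite_simple_graph G" "i \<in> vertices G"
  shows "facet_pyramid G i \<in> sets (Pi\<^sub>M (vertices G) (\<lambda>_. lborel))"
proof -
  have [simp]: "finite (vertices G)" using assms by (simp add: finite_simple_graph_def)
  have "(\<lambda>x. x j) \<in> borel_measurable (Pi\<^sub>M (vertices G) (\<lambda>_. lborel :: real measure))"
    if "j \<in> vertices G" for j
    using measurable_component_singleton[OF that, of "\<lambda>_. lborel :: real measure"] by simp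
  then have "{x \<in> space (Pi\<^sub>M (vertices G) (\<lambda>_. lborel)). \<forall>j\<in>vertices G. x i \<le> (x j :: real)}
      \<in> sets (Pi\<^sub>M (vertices G) (\<lambda>_. lborel))"
    using assms(2) by (intro sets.sets_Collect_finite_All borel_measurable_le) auto
  moreover have "facet_pyramid G i = graph_polytope G \<inter>
      {x \<in> space (Pi\<^sub>M (vertices G) (\<lambda>_. lborel)). \<forall>j\<in>vertices G. x i \<le> x j}"
    by (auto simp: facet_pyramid_def graph_polytope_def space_PiM PiE_iff)
  ultimately show ?thesis
    using sets_graph_polytope[OF assms(1)] by simp
qed

section \<open>Neighbours, and the slices of a pyramid parallel to its facet\<close>

lemma neighbour_exists:
  assumes "finite_simple_graph G" "\<not> (\<exists>i. isolated_vertex G i)" "i \<in> vertices G"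
  obtains j where "{i, j} \<in> edges G" "j \<in> vertices G"
proof -
  obtain e where e: "e \<in> edges G" "i \<in> e"
    using assms by (auto simp: isolated_vertex_def)
  then have "card e = 2" "e \<subseteq> vertices G"
    using assms by (auto simp: finite_simple_graph_def)
  with e obtain j where "e = {i, j}" "j \<noteq> i"
    by (auto simp: card_2_iff doubleton_eq_iff)
  with e \<open>e \<subseteq> vertices G\<close> show ?thesis by (intro that) auto
qed

text \<open>Twice the minimal coordinate is at most its sum with the coordinate of a neighbour,
  hence at most 1. For an isolated vertex the bound 1/2 can fail.\<close>

lemma facet_pyramid_coord_bounds:
  assumes "finite_simple_graph G" "\<not> (\<exists>i. isolated_vertex G i)" "i \<in> vertices G"
    and "x \<in> facet_pyramid G i"
  shows "x i \<in> {0..1/2}"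
proof -
  obtain j where "{i, j} \<in> edges G" "j \<in> vertices G"
    using neighbour_exists[OF assms(1-3)] .
  with assms(4) have "x i + x j \<le> 1" "x i \<le> x j"
    by (auto simp: facet_pyramid_def graph_polytope_def)
  moreover have "0 \<le> x i" using assms(3,4) by (auto simp: facet_pyramid_def graph_polytope_def)
  ultimately show ?thesis by simp
qed

text \<open>The point is the convex combination of the apex with weight \<open>2 * s\<close> and of
  the facet point \<open>w\<close>, extended by 0 at \<open>i\<close>, with weight
  \<open>1 - 2 * s\<close>. So the slice at height \<open>s\<close> is the facet shrunk by
  \<open>1 - 2 * s\<close>, which is positive as \<open>s < 1/2\<close>.\<close>

lemma facet_pyramid_section_iff:
  fixes s :: real
  assumes G: "finite_simple_graph G" "\<not> (\<exists>i. isolated_vertex G i)" "i \<in> vertices G"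
    and s: "0 \<le> s" "s < 1/2"
    and w: "w \<in> extensional (vertices G - {i})"
  shows "(\<lambda>j\<in>vertices G - {i}. s + (1 - 2 * s) * w j)(i := s) \<in> facet_pyramid G i
    \<longleftrightarrow> w \<in> graph_polytope (delete_vertex G i)" (is "?x \<in> _ \<longleftrightarrow> _")
proof
  have c: "0 < 1 - 2 * s" using s by simp
  have V: "j \<in> vertices G \<and> k \<in> vertices G \<and> j \<noteq> k" if "{j, k} \<in> edges G" for j k
    using G(1) that by (force simp: finite_simple_graph_def)
  have x: "?x j = s + (1 - 2 * s) * w j" if "j \<in> vertices G" "j \<noteq> i" for j
    using that by simp
  have xi: "?x i = s" by simp
  \<comment> \<open>Both sides contain the summand \<open>2 * s\<close>, as
    \<open>1 = 2 * s + (1 - 2 * s)\<close>; what remains is scaled by a positive factor.\<close>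
  have sum1: "s + (1 - 2 * s) * a + (s + (1 - 2 * s) * b) \<le> 1 \<longleftrightarrow> a + b \<le> 1" for a b
  proof -
    have "s + (1 - 2 * s) * a + (s + (1 - 2 * s) * b) \<le> 1
        \<longleftrightarrow> (1 - 2 * s) * (a + b) \<le> (1 - 2 * s) * 1"
      by (simp add: algebra_simps)
    also have "\<dots> \<longleftrightarrow> a + b \<le> 1" using c by (rule mult_le_cancel_left_pos)
    finally show ?thesis .
  qed
  \<comment> \<open>Coordinate \<open>i\<close> corresponds to the value 0 on the facet, so
    constraints of edges at \<open>i\<close> turn into upper bounds by 1.\<close>
  have sum2: "s + (s + (1 - 2 * s) * a) \<le> 1 \<longleftrightarrow> a \<le> 1" for a
    using sum1[of 0 a] by simp
  {
    assume L: "?x \<in> facet_pyramid G i"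
    have E: "?x j + ?x k \<le> 1" if "{j, k} \<in> edges G" for j k
      using L that unfolding facet_pyramid_def graph_polytope_def by blast
    have min: "?x i \<le> ?x j" if "j \<in> vertices G" for j
      using L that unfolding facet_pyramid_def by blast
    have pos: "0 \<le> w j" if "j \<in> vertices G" "j \<noteq> i" for j
    proof -
      have "0 \<le> (1 - 2 * s) * w j" using min[OF that(1)] unfolding xi x[OF that] by simp
      with c show ?thesis by (simp add: zero_le_mult_iff)
    qed
    have edge: "w j + w k \<le> 1" if "{j, k} \<in> edges G" "j \<noteq> i" "k \<noteq> i" for j k
      using E[OF that(1)] V[OF that(1)] sum1 x[of j] x[of k] that(2,3) by metis
    \<comment> \<open>The upper bound comes from a neighbour \<open>k\<close> of \<open>j\<close>:
      directly from the edge if \<open>k = i\<close>, and otherwise from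
      \<open>w j + w k \<le> 1\<close> with \<open>w k\<close> nonnegative.\<close>
    have le: "w j \<le> 1" if j: "j \<in> vertices G" "j \<noteq> i" for j
    proof -
      obtain k where k: "{j, k} \<in> edges G" "k \<in> vertices G"
        using neighbour_exists[OF G(1,2) j(1)] .
      show ?thesis
      proof (cases "k = i")
        case True
        then have "?x i + ?x j \<le> 1" using E[OF k(1)] by simp
        then show ?thesis unfolding xi x[OF j] sum2 .
      next
        case False
        then show ?thesis using edge[OF k(1)] pos[OF k(2)] j by simp
      qed
    qed
    show "w \<in> graph_polytope (delete_vertex G i)"
      using w pos le edge by (auto simp: graph_polytope_def delete_vertex_def PiE_iff)
  }
  {
    assume R: "w \<in> graph_polytope (delete_vertex G i)"
    have pos: "0 \<le> w j" and le: "w j \<le> 1" if "j \<in> vertices G" "j \<noteq> i" for j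
      using R that by (auto simp: graph_polytope_def delete_vertex_def PiE_iff)
    have edge: "w j + w k \<le> 1" if "{j, k} \<in> edges G" "j \<noteq> i" "k \<noteq> i" for j k
      using R that by (auto simp: graph_polytope_def delete_vertex_def)
    have min: "s \<le> ?x j" if "j \<in> vertices G" for j
      using c pos[OF that] by (cases "j = i") (auto simp: that)
    \<comment> \<open>This one bound yields the constraints of all edges at \<open>i\<close> and, as
      \<open>s\<close> is nonnegative, also \<open>?x j \<le> 1\<close>.\<close>
    have sx: "s + ?x j \<le> 1" if "j \<in> vertices G" for j
    proof (cases "j = i")
      case True
      then show ?thesis using s by simp
    next
      case False
      show ?thesis unfolding x[OF that False] sum2 using le[OF that False] .
    qed
    have E: "?x j + ?x k \<le> 1" if "{j, k} \<in> edges G" for j k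
    proof -
      consider "j = i" | "k = i" | "j \<noteq> i" "k \<noteq> i" by blast
      then show ?thesis
      proof cases
        case 1
        then show ?thesis using sx[of k] V[OF that] by simp
      next
        case 2
        then show ?thesis using sx[of j] V[OF that] by (simp add: add.commute)
      next
        case 3
        then show ?thesis using V[OF that] x[of j] x[of k] sum1 edge[OF that] by metis
      qed
    qed
    have "?x \<in> vertices G \<rightarrow>\<^sub>E {0..1}"
    proof (rule PiE_I)
      show "?x j \<in> {0..1}" if "j \<in> vertices G" for j
        unfolding atLeastAtMost_iff using min[OF that] sx[OF that] s by linarith
    qed (use G(3) in auto)
    then show "?x \<in> facet_pyramid G i"
      unfolding facet_pyramid_def graph_polytope_def mem_Collect_eq xi
      using E min by blast
  }
qed

section \<open>The volume of a pyramid\<close>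

lemma nn_integral_pyramid_height:
  "(\<integral>\<^sup>+s. ennreal ((1 - 2 * s) ^ m) * indicator {0..1/2} s \<partial>lborel) = ennreal (1 / (2 * real (Suc m)))"
proof -
  have "(\<integral>\<^sup>+s. ennreal ((1 - 2 * s) ^ m) * indicator {0..1/2} s \<partial>lborel)
      = ennreal (- ((1 - 2 * (1/2)) ^ Suc m) / (2 * real (Suc m)) -
          (- ((1 - 2 * 0) ^ Suc m) / (2 * real (Suc m))))"
  \<comment> \<open>The antiderivative vanishes at the apex height 1/2, so only its value at the
    base \<open>s = 0\<close> survives.\<close>
  proof (rule nn_integral_FTC_Icc)
    fix x :: real
    have "((\<lambda>s. - ((1 - 2 * s) ^ Suc m) / (2 * real (Suc m))) has_real_derivative
        - (real (Suc m) * (1 - 2 * x) ^ m * (- 2)) / (2 * real (Suc m))) (at x)"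
      by (auto intro!: derivative_eq_intros simp del: power_Suc of_nat_Suc)
    then show "((\<lambda>s. - ((1 - 2 * s) ^ Suc m) / (2 * real (Suc m))) has_real_derivative
        (1 - 2 * x) ^ m) (at x)"
      by (simp del: of_nat_Suc power_Suc)
  qed auto
  then show ?thesis by simp
qed

text \<open>Integrating the slice volumes \<open>(1 - 2 * s) ^ card W\<close> times the volume for
  \<open>G - i\<close> over the height \<open>s\<close>; here \<open>Suc (card W)\<close> is the
  number of vertices, which produces the denominator.\<close>

lemma emeasure_facet_pyramid:
  assumes G: "finite_simple_graph G" "\<not> (\<exists>i. isolated_vertex G i)" "i \<in> vertices G"
  shows "emeasure (Pi\<^sub>M (vertices G) (\<lambda>_. lborel)) (facet_pyramid G i) =
    ennreal (graph_vol (delete_vertex G i) / (2 * real (card (vertices G))))"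
proof -
  interpret product_sigma_finite "\<lambda>_::'a. lborel :: real measure"
    by (rule product_sigma_finite_lborel)
  define W where "W = vertices G - {i}"
  let ?M = "\<lambda>I. Pi\<^sub>M I (\<lambda>_::'a. lborel :: real measure)"
  let ?P = "graph_polytope (delete_vertex G i)"
  have fin: "finite W" and iW: "i \<notin> W" and V: "vertices G = insert i W"
    using G by (auto simp: W_def finite_simple_graph_def)
  have D: "vertices (delete_vertex G i) = W" by (simp add: delete_vertex_def W_def)
  note [measurable] = sets_facet_pyramid[OF G(1,3), unfolded V]
  have P: "?P \<in> fmeasurable (?M W)"
    using fmeasurable_graph_polytope[OF finite_simple_graph_delete_vertex[OF G(1)], of i]
    unfolding D .
  \<comment> \<open>At \<open>s = 1/2\<close> the scaling factor is 0 and the substitution breaks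
    down; this single height is later discarded as a null set.\<close>
  have slice: "(\<integral>\<^sup>+z. indicator (facet_pyramid G i) (z(i := s)) \<partial>?M W) =
      ennreal ((1 - 2 * s) ^ card W) * indicator {0..1/2} s * emeasure (?M W) ?P"
    if "s \<noteq> 1/2" for s
  proof (cases "s \<in> {0..1/2}")
    case True
    with that have s: "0 \<le> s" "s < 1/2" by auto
    have "(\<integral>\<^sup>+z. indicator (facet_pyramid G i) (z(i := s)) \<partial>?M W) =
        ennreal (\<bar>1 - 2 * s\<bar> ^ card W) *
        (\<integral>\<^sup>+w. indicator (facet_pyramid G i) ((\<lambda>j\<in>W. s + (1 - 2 * s) * w j)(i := s)) \<partial>?M W)"
      using s by (intro nn_integral_PiM_lborel_affine fin) (auto, measurable)
    also have "(\<integral>\<^sup>+w. indicator (facet_pyramid G i) ((\<lambda>j\<in>W. s + (1 - 2 * s) * w j)(i := s)) \<partial>?M W)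
        = (\<integral>\<^sup>+w. indicator ?P w \<partial>?M W)"
      using facet_pyramid_section_iff[OF G s, folded W_def]
      by (intro nn_integral_cong) (auto simp: indicator_def space_PiM PiE_iff)
    also have "\<dots> = emeasure (?M W) ?P" using P by simp
    finally show ?thesis using True by (simp add: fun_upd_def)
  next
    case False
    have "z(i := s) \<notin> facet_pyramid G i" for z
      using facet_pyramid_coord_bounds[OF G, of "z(i := s)"] False by auto
    with False show ?thesis by simp
  qed
  have "emeasure (?M (vertices G)) (facet_pyramid G i) =
      (\<integral>\<^sup>+x. indicator (facet_pyramid G i) x \<partial>?M (insert i W))"
    using V by simp
  \<comment> \<open>Coordinate \<open>i\<close> is integrated last, so that the inner integral is
    the volume of a slice.\<close>
  also have "\<dots> = (\<integral>\<^sup>+s. (\<integral>\<^sup>+z. indicator (facet_pyramid G i) (z(i := s)) \<partial>?M W) \<partial>lborel)"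
    by (intro product_nn_integral_insert_rev fin iW) measurable
  also have "\<dots> = (\<integral>\<^sup>+s. ennreal ((1 - 2 * s) ^ card W) * indicator {0..1/2} s *
      emeasure (?M W) ?P \<partial>lborel)"
    using AE_lborel_singleton[of "1/2 :: real"] slice by (intro nn_integral_cong_AE) auto
  also have "\<dots> = ennreal (1 / (2 * real (Suc (card W)))) * emeasure (?M W) ?P"
    by (subst nn_integral_multc) (auto simp: nn_integral_pyramid_height)
  also have "emeasure (?M W) ?P = ennreal (graph_vol (delete_vertex G i))"
    using P by (simp add: graph_vol_def D emeasure_eq_measure2)
  finally show ?thesis
    using fin iW by (simp add: V ennreal_mult[symmetric] graph_vol_def del: of_nat_Suc)
qed

section \<open>Assembling the polytope from its pyramids\<close>

lemma graph_polytope_eq_Union_pyramids: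
  assumes "finite (vertices G)" "vertices G \<noteq> {}"
  shows "graph_polytope G = (\<Union>i\<in>vertices G. facet_pyramid G i)"
proof -
  \<comment> \<open>A minimum exists because the vertex set is finite and nonempty; for the graph
    without vertices and edges the polytope is one point but the union is empty.\<close>
  have "\<exists>i\<in>vertices G. \<forall>j\<in>vertices G. x i \<le> x j" for x :: "'a \<Rightarrow> real"
    using assms arg_min_if_finite(1) arg_min_least by metis
  then show ?thesis by (fastforce simp: facet_pyramid_def)
qed

lemma graph_vol_eq_sum_delete_vertex:
  assumes G: "finite_simple_graph G" "\<not> (\<exists>i. isolated_vertex G i)" and "vertices G \<noteq> {}"
  shows "graph_vol G =
    (\<Sum>i\<in>vertices G. graph_vol (delete_vertex G i) / (2 * real (card (vertices G))))"
proof -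
  let ?M = "Pi\<^sub>M (vertices G) (\<lambda>_. lborel :: real measure)"
  have fin: "finite (vertices G)" using G by (simp add: finite_simple_graph_def)
  have "graph_vol G = measure ?M (\<Union>i\<in>vertices G. facet_pyramid G i)"
    using graph_polytope_eq_Union_pyramids[OF fin assms(3)] by (simp add: graph_vol_def)
  also have "\<dots> = (\<Sum>i\<in>vertices G. measure ?M (facet_pyramid G i))"
  \<comment> \<open>The pyramids share boundary points, such as the apex, so additivity is needed in
    its almost-everywhere form.\<close>
  proof (rule measure_UNION_AE[OF fin])
    show "facet_pyramid G i \<in> fmeasurable ?M" if "i \<in> vertices G" for i
      using sets_facet_pyramid[OF G(1) that] emeasure_facet_pyramid[OF G that]
      by (intro fmeasurableI) auto
    show "pairwise (\<lambda>i j. AE x in ?M. x \<notin> facet_pyramid G i \<or> x \<notin> facet_pyramid G j) (vertices G)"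
    proof (rule pairwiseI)
      fix i j assume ij: "i \<in> vertices G" "j \<in> vertices G" "i \<noteq> j"
      \<comment> \<open>In a common point each of \<open>x i\<close> and \<open>x j\<close> is at
        most the other, so they agree.\<close>
      show "AE x in ?M. x \<notin> facet_pyramid G i \<or> x \<notin> facet_pyramid G j"
        using AE_PiM_lborel_neq[OF fin ij]
        by eventually_elim (use ij in \<open>force simp: facet_pyramid_def\<close>)
    qed
  qed
  also have "\<dots> = (\<Sum>i\<in>vertices G. graph_vol (delete_vertex G i) / (2 * real (card (vertices G))))"
    by (intro sum.cong refl measure_eq_emeasure_eq_ennreal emeasure_facet_pyramid G)
      (auto simp: graph_vol_def)
  finally show ?thesis .
qed

theorem theorem2p3:
  fixes G :: "nat ugraph" and n :: nat
  assumes "n \<ge> 1"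
    and "finite_simple_graph G"
    and "vertices G = {1..n}"
    and "\<not> (\<exists>i. isolated_vertex G i)"
  shows "graph_vol G = (\<Sum>i=1..n. graph_vol (delete_vertex G i) / (2 * real n))"
  using graph_vol_eq_sum_delete_vertex[OF assms(2,4)] assms(1,3) by simp

end
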